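(* Let $k,N,g,h\ge 1$ be integers and $\alpha\in\mathbb{R}$. For a multi-channel convolution kernel $K\in\mathbb{R}^{k\times k\times g\times h}$ let $M=M(K)=(m_{ij})\in\mathbb{R}^{hN^2\times gN^2}$ be the structured transformation matrix corresponding to $K$ (acting on $N\times N\times g$ inputs). Given $(p,q,z,y)$ with $p,q\in\{1,\dots,k\}$, $z\in\{1,\dots,g\}$, $y\in\{1,\dots,h\}$, let $\Omega_{p,q,z,y}$ be the set of all index pairs $(i,j)\in\{1,\dots,hN^2\}\times\{1,\dots,gN^2\}$ such that $m_{ij}=K_{p,q,z,y}$, i.e. the positions of $M$ occupied by the parameter $K_{p,q,z,y}$ (equality of $m_{ij}$ and $K_{p,q,z,y}$ as functions of $K$). Then, regarding $\|M^TM-\alpha I\|_F^2$ as a function of the entries of $K$, $$\frac12\,\frac{\partial \|M^TM-\alpha I\|_F^2}{\partial K_{p,q,z,y}}=\sum_{(i,j)\in\Omega_{p,q,z,y}}\left(\sum_{t=1}^{gN^2}(M^TM-\alpha I)_{j,t}\,m_{it}+\sum_{s=1}^{gN^2}(M^TM-\alpha I)_{s,j}\,m_{is}\right).$$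
   Context: $\|\cdot\|_F$ is the Frobenius norm, $I$ is the $gN^2\times gN^2$ identity matrix, and $(B)_{s,t}$ denotes the $(s,t)$ entry of a matrix $B$. Multi-channel convolution (deep-learning convention, no flip, unit stride, zero padding, output of the same spatial size): for $K\in\mathbb{R}^{k\times k\times g\times h}$ and $X\in\mathbb{R}^{N\times N\times g}$, the output $Y=K*X\in\mathbb{R}^{N\times N\times h}$ is $$Y_{r,s,c}=\sum_{d=1}^{g}\sum_{p=1}^{k}\sum_{q=1}^{k}X_{r-m+p,\,s-m+q,\,d}\,K_{p,q,d,c},\qquad m=\lceil k/2\rceil,$$ where $X_{i,j,d}=0$ if $i\le 0$ or $i>N$ or $j\le 0$ or $j>N$. For a 3-dimensional tensor $X$, $\mathrm{vec}(X)$ is the column vector obtained by stacking the columns of the flattening of $X$ along the first index, i.e. the entry $X_{i,j,d}$ is in position $(d-1)N^2+(j-1)N+i$. The transformation matrix corresponding to $K$ is the unique $M\in\mathbb{R}^{hN^2\times gN^2}$ with $\mathrm{vec}(K*X)=M\,\mathrm{vec}(X)$ for all $X\in\mathbb{R}^{N\times N\times g}$. It has the block form $$M=\begin{pmatrix} M_{(1)(1)} & M_{(1)(2)} & \cdots & M_{(1)(g)}\\ M_{(2)(1)} & M_{(2)(2)} & \cdots & M_{(2)(g)}\\ \vdots & \vdots & & \vdots\\ M_{(h)(1)} & M_{(h)(2)} & \cdots & M_{(h)(g)}\end{pmatrix},$$ where each $M_{(c)(d)}$ is the $N^2\times N^2$ doubly block banded Toeplitz matrix corresponding to the portion $K_{:,:,d,c}\in\mathbb{R}^{k\times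 k}$ of $K$, which describes the effect of the $d$-th input channel on the $c$-th output channel. Every position of $M$ is either identically zero or is occupied by exactly one parameter: for $r,s,r',s'\in\{1,\dots,N\}$, the entry of $M_{(c)(d)}$ in row $(s-1)N+r$ and column $(s'-1)N+r'$ equals $K_{p,q,d,c}$ with $p=r'-r+m$, $q=s'-s+m$ if $1\le p,q\le k$, and equals $0$ otherwise. *)

theory Defs
  imports Complex_Main "Jordan_Normal_Form.Matrix"
begin

text \<open>
  Tensors are functions on index tuples that are 1-based, as in the mathematical text. A kernel
  \<open>K \<in> R^(k \<times> k \<times> g \<times> h)\<close> is read only at \<open>(p, q, d, c)\<close> with \<open>p, q \<in> {1..k}\<close>, \<open>d \<in> {1..g}\<close>,
  \<open>c \<in> {1..h}\<close>, and an \<open>N \<times> N \<times> C\<close> tensor only at \<open>(i, j, d)\<close> with \<open>i, j \<in> {1..N}\<close>,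
  \<open>d \<in> {1..C}\<close>; values elsewhere are irrelevant. Matrices and vectors are those of
  \<open>Jordan_Normal_Form\<close>, whose indices are 0-based: the position \<open>(i, j)\<close> of the text is the
  position \<open>(i - 1, j - 1)\<close> here.
\<close>

type_synonym tensor3 = "nat \<times> nat \<times> nat \<Rightarrow> real"
type_synonym kernel = "nat \<times> nat \<times> nat \<times> nat \<Rightarrow> real"

definition zero_padded :: "nat \<Rightarrow> tensor3 \<Rightarrow> int \<Rightarrow> int \<Rightarrow> nat \<Rightarrow> real" where
  "zero_padded N X i j d =
     (if i \<le> 0 \<or> i > int N \<or> j \<le> 0 \<or> j > int N then 0 else X (nat i, nat j, d))"

definition conv :: "nat \<Rightarrow> nat \<Rightarrow> nat \<Rightarrow> kernel \<Rightarrow> tensor3 \<Rightarrow> tensor3" where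
  "conv k N g K X = (\<lambda>(r, s, c).
     let m = \<lceil>real k / 2\<rceil> in
     \<Sum>d = 1..g. \<Sum>p = 1..k. \<Sum>q = 1..k.
       zero_padded N X (int r - m + int p) (int s - m + int q) d * K (p, q, d, c))"

text \<open>The entry with 1-based index \<open>(i, j, d)\<close> is stored at the 0-based position
  \<open>(d - 1) N^2 + (j - 1) N + (i - 1)\<close>; see \<open>flatten_index\<close>.\<close>

definition flatten :: "nat \<Rightarrow> nat \<Rightarrow> tensor3 \<Rightarrow> real vec" where
  "flatten N C X =
     vec (C * N\<^sup>2) (\<lambda>l. X (l mod N + 1, l div N mod N + 1, l div N\<^sup>2 + 1))"

text \<open>Existence and uniqueness are \<open>transformation_matrix_ex1\<close>.\<close>

definition transformation_matrix ::
    "nat \<Rightarrow> nat \<Rightarrow> nat \<Rightarrow> nat \<Rightarrow> kernel \<Rightarrow> real mat" where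
  "transformation_matrix k N g h K =
     (THE M. M \<in> carrier_mat (h * N\<^sup>2) (g * N\<^sup>2) \<and>
             (\<forall>X. flatten N h (conv k N g K X) = M *\<^sub>v flatten N g X))"

definition frobenius_norm :: "real mat \<Rightarrow> real" where
  "frobenius_norm A = sqrt (\<Sum>i<dim_row A. \<Sum>j<dim_col A. (A $$ (i, j))\<^sup>2)"

text \<open>The equality \<open>m_ij = K_(p,q,z,y)\<close> defining the positions of a parameter is one of functions
  of the kernel, hence the quantifier over all kernels.\<close>

definition param_positions ::
    "nat \<Rightarrow> nat \<Rightarrow> nat \<Rightarrow> nat \<Rightarrow> nat \<times> nat \<times> nat \<times> nat \<Rightarrow> (nat \<times> nat) set" where
  "param_positions k N g h idx =
     {(i, j). i < h * N\<^sup>2 \<and> j < g * N\<^sup>2 \<and>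
              (\<forall>K. transformation_matrix k N g h K $$ (i, j) = K idx)}"

definition has_partial_derivative :: "(kernel \<Rightarrow> real) \<Rightarrow> real \<Rightarrow> kernel \<Rightarrow>
    nat \<times> nat \<times> nat \<times> nat \<Rightarrow> bool" where
  "has_partial_derivative F D K idx \<longleftrightarrow>
     ((\<lambda>x. F (K(idx := x))) has_real_derivative D) (at (K idx))"

lemma flatten_position_less:
  fixes i j d N C :: nat
  assumes "i < N" "j < N" "d < C"
  shows "d * N\<^sup>2 + j * N + i < C * N\<^sup>2"
proof -
  have "j * N + i < N\<^sup>2"
  proof -
    have "j * N + i < Suc j * N" using assms by simp
    also have "\<dots> \<le> N * N" using assms by (intro mult_right_mono) auto
    finally show ?thesis by (simp add: power2_eq_square)
  qed
  then have "d * N\<^sup>2 + j * N + i < Suc d * N\<^sup>2" by simp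
  also have "\<dots> \<le> C * N\<^sup>2" using assms by (intro mult_right_mono) auto
  finally show ?thesis .
qed

lemma flatten_position:
  fixes i j d N :: nat
  assumes "i < N" "j < N"
  shows "(d * N\<^sup>2 + j * N + i) mod N = i"
    and "(d * N\<^sup>2 + j * N + i) div N mod N = j"
    and "(d * N\<^sup>2 + j * N + i) div N\<^sup>2 = d"
proof -
  have eq: "d * N\<^sup>2 + j * N + i = (d * N + j) * N + i"
    by (simp add: power2_eq_square algebra_simps)
  have dN: "(d * N\<^sup>2 + j * N + i) div N = d * N + j"
    unfolding eq using assms by (simp add: div_add1_eq)
  show "(d * N\<^sup>2 + j * N + i) mod N = i" unfolding eq using assms by simp
  show "(d * N\<^sup>2 + j * N + i) div N mod N = j" unfolding dN using assms by simp
  have "(d * N\<^sup>2 + j * N + i) div N\<^sup>2 = (d * N\<^sup>2 + j * N + i) div N div N"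
    by (simp add: power2_eq_square div_mult2_eq)
  also have "\<dots> = d" unfolding dN using assms by (simp add: div_add1_eq)
  finally show "(d * N\<^sup>2 + j * N + i) div N\<^sup>2 = d" .
qed

lemma flatten_index:
  assumes "i \<in> {1..N}" "j \<in> {1..N}" "d \<in> {1..C}"
  shows "flatten N C X $ ((d - 1) * N\<^sup>2 + (j - 1) * N + (i - 1)) = X (i, j, d)"
proof -
  have "i - 1 < N" "j - 1 < N" "d - 1 < C" using assms by auto
  then show ?thesis
    using assms flatten_position_less[of "i - 1" N "j - 1" "d - 1" C]
      flatten_position[of "i - 1" N "j - 1" "d - 1"]
    by (simp add: flatten_def)
qed

definition unit_tensor :: "nat \<times> nat \<times> nat \<Rightarrow> tensor3" where
  "unit_tensor a b = (if b = a then 1 else 0)"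

definition tensor_index :: "nat \<Rightarrow> nat \<Rightarrow> nat \<times> nat \<times> nat" where
  "tensor_index N l = (l mod N + 1, l div N mod N + 1, l div N\<^sup>2 + 1)"

lemma flatten_tensor_index:
  "l < C * N\<^sup>2 \<Longrightarrow> flatten N C X $ l = X (tensor_index N l)"
  by (simp add: flatten_def tensor_index_def)

lemma tensor_index_position:
  assumes "i \<in> {1..N}" "j \<in> {1..N}"  "d \<ge> 1"
  shows "tensor_index N ((d - 1) * N\<^sup>2 + (j - 1) * N + (i - 1)) = (i, j, d)"
proof -
  have "i - 1 < N" "j - 1 < N" using assms by auto
  from flatten_position[OF this, of "d - 1"] show ?thesis
    using assms by (simp add: tensor_index_def)
qed

lemma tensor_index_inj:
  assumes "tensor_index N l = tensor_index N l'"
  shows "l = l'"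
proof -
  have e: "l mod N = l' mod N" "l div N mod N = l' div N mod N" "l div N div N = l' div N div N"
    using assms by (simp_all add: tensor_index_def power2_eq_square div_mult2_eq)
  have "l div N = l' div N" using e(2,3) by (metis div_mult_mod_eq)
  then show ?thesis using e(1) by (metis div_mult_mod_eq)
qed

lemma flatten_unit_tensor:
  "l < C * N\<^sup>2 \<Longrightarrow> flatten N C (unit_tensor (tensor_index N l)) = unit_vec (C * N\<^sup>2) l"
  by (intro eq_vecI)
    (auto simp: flatten_tensor_index unit_tensor_def unit_vec_def flatten_def
      tensor_index_def[symmetric] simp del: One_nat_def add_Suc_right Suc_eq_plus1_left
      dest: tensor_index_inj)

lemma zero_padded_expand:
  assumes "d \<in> {1..g}"
  shows "zero_padded N X i j d =
    (\<Sum>l<g * N\<^sup>2. zero_padded N (unit_tensor (tensor_index N l)) i j d * X (tensor_index N l))"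
proof (cases "i \<le> 0 \<or> i > int N \<or> j \<le> 0 \<or> j > int N")
  case True
  then show ?thesis by (simp add: zero_padded_def)
next
  case False
  define l0 where "l0 = (d - 1) * N\<^sup>2 + (nat j - 1) * N + (nat i - 1)"
  have idx: "tensor_index N l0 = (nat i, nat j, d)"
    unfolding l0_def using False assms by (intro tensor_index_position) auto
  have "l0 < g * N\<^sup>2"
    unfolding l0_def using False assms by (intro flatten_position_less) auto
  have "(\<Sum>l<g * N\<^sup>2. zero_padded N (unit_tensor (tensor_index N l)) i j d * X (tensor_index N l))
      = (\<Sum>l<g * N\<^sup>2. if l = l0 then X (tensor_index N l0) else 0)"
    using False idx
    by (intro sum.cong) (auto simp: zero_padded_def unit_tensor_def dest: tensor_index_inj
        simp flip: idx)
  also have "\<dots> = X (nat i, nat j, d)"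
    using \<open>l0 < g * N\<^sup>2\<close> idx by simp
  finally show ?thesis using False by (simp add: zero_padded_def)
qed

lemma conv_expand:
  "conv k N g K X a =
    (\<Sum>l<g * N\<^sup>2. conv k N g K (unit_tensor (tensor_index N l)) a * X (tensor_index N l))"
proof -
  obtain r s c where a: "a = (r, s, c)" by (cases a)
  let ?m = "\<lceil>real k / 2\<rceil>"
  let ?z = "\<lambda>X d p q. zero_padded N X (int r - ?m + int p) (int s - ?m + int q) d"
  have "conv k N g K X a = (\<Sum>d = 1..g. \<Sum>p = 1..k. \<Sum>q = 1..k. \<Sum>l<g * N\<^sup>2.
      ?z (unit_tensor (tensor_index N l)) d p q * K (p, q, d, c) * X (tensor_index N l))"
    unfolding a conv_def Let_def prod.case
    by (intro sum.cong refl, subst zero_padded_expand[where g = g])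
      (auto simp: sum_distrib_left sum_distrib_right mult_ac)
  also have "\<dots> = (\<Sum>l<g * N\<^sup>2. \<Sum>d = 1..g. \<Sum>p = 1..k. \<Sum>q = 1..k.
      ?z (unit_tensor (tensor_index N l)) d p q * K (p, q, d, c) * X (tensor_index N l))"
    by (simp only: sum.swap[of _ _ "{..<g * N\<^sup>2}"])
  also have "\<dots> = (\<Sum>l<g * N\<^sup>2. conv k N g K (unit_tensor (tensor_index N l)) a * X (tensor_index N l))"
    by (simp add: a conv_def Let_def sum_distrib_right)
  finally show ?thesis .
qed

lemma transformation_matrix_ex1:
  "\<exists>!M. M \<in> carrier_mat (h * N\<^sup>2) (g * N\<^sup>2) \<and>
        (\<forall>X. flatten N h (conv k N g K X) = M *\<^sub>v flatten N g X)"
proof (rule ex1I)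
  let ?M = "mat (h * N\<^sup>2) (g * N\<^sup>2)
    (\<lambda>(i, j). conv k N g K (unit_tensor (tensor_index N j)) (tensor_index N i))"
  have "flatten N h (conv k N g K X) = ?M *\<^sub>v flatten N g X" for X
  proof (rule eq_vecI)
    fix i assume "i < dim_vec (?M *\<^sub>v flatten N g X)"
    then have i: "i < h * N\<^sup>2" by simp
    have "flatten N h (conv k N g K X) $ i = conv k N g K X (tensor_index N i)"
      using i by (rule flatten_tensor_index)
    also have "\<dots> = (?M *\<^sub>v flatten N g X) $ i"
      using i by (subst conv_expand)
        (simp add: scalar_prod_def flatten_def tensor_index_def atLeast0LessThan)
    finally show "flatten N h (conv k N g K X) $ i = (?M *\<^sub>v flatten N g X) $ i" .
  qed (simp add: flatten_def)
  then show "?M \<in> carrier_mat (h * N\<^sup>2) (g * N\<^sup>2) \<and>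
      (\<forall>X. flatten N h (conv k N g K X) = ?M *\<^sub>v flatten N g X)" by simp
  fix M assume M: "M \<in> carrier_mat (h * N\<^sup>2) (g * N\<^sup>2) \<and>
      (\<forall>X. flatten N h (conv k N g K X) = M *\<^sub>v flatten N g X)"
  show "M = ?M"
  proof (rule eq_matI)
    fix i j assume "i < dim_row ?M" "j < dim_col ?M"
    then have i: "i < h * N\<^sup>2" and j: "j < g * N\<^sup>2" by auto
    have "conv k N g K (unit_tensor (tensor_index N j)) (tensor_index N i)
        = (M *\<^sub>v flatten N g (unit_tensor (tensor_index N j))) $ i"
      using M flatten_tensor_index[OF i] by metis
    also have "\<dots> = (M *\<^sub>v unit_vec (g * N\<^sup>2) j) $ i"
      using j by (simp add: flatten_unit_tensor)
    also have "\<dots> = M $$ (i, j)"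
      using M i j by auto
    finally show "M $$ (i, j) = ?M $$ (i, j)" using i j by simp
  qed (use M in auto)
qed

lemma transformation_matrix_carrier:
  "transformation_matrix k N g h K \<in> carrier_mat (h * N\<^sup>2) (g * N\<^sup>2)"
  unfolding transformation_matrix_def using theI'[OF transformation_matrix_ex1] by blast

lemma transformation_matrix_mult_vec:
  "flatten N h (conv k N g K X) = transformation_matrix k N g h K *\<^sub>v flatten N g X"
  unfolding transformation_matrix_def using theI'[OF transformation_matrix_ex1] by blast

lemma transformation_matrix_entry:
  fixes k N g h r s r' s' c d :: nat and K :: kernel
  assumes ranges: "r \<in> {1..N}" "s \<in> {1..N}" "r' \<in> {1..N}" "s' \<in> {1..N}" "c \<in> {1..h}" "d \<in> {1..g}"
  defines "p \<equiv> int r' - int r + \<lceil>real k / 2\<rceil>" and "q \<equiv> int s' - int s + \<lceil>real k / 2\<rceil>"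
  shows "transformation_matrix k N g h K $$
      ((c - 1) * N\<^sup>2 + (s - 1) * N + (r - 1), (d - 1) * N\<^sup>2 + (s' - 1) * N + (r' - 1)) =
    (if p \<in> {1..int k} \<and> q \<in> {1..int k} then K (nat p, nat q, d, c) else 0)"
proof -
  define i where "i = (c - 1) * N\<^sup>2 + (s - 1) * N + (r - 1)"
  define j where "j = (d - 1) * N\<^sup>2 + (s' - 1) * N + (r' - 1)"
  let ?M = "transformation_matrix k N g h K" and ?m = "\<lceil>real k / 2\<rceil>"
  have i: "i < h * N\<^sup>2" unfolding i_def using ranges by (intro flatten_position_less) auto
  have j: "j < g * N\<^sup>2" unfolding j_def using ranges by (intro flatten_position_less) auto
  have ti: "tensor_index N i = (r, s, c)"
    unfolding i_def using ranges by (intro tensor_index_position) auto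
  have tj: "tensor_index N j = (r', s', d)"
    unfolding j_def using ranges by (intro tensor_index_position) auto
  have "?M $$ (i, j) = (?M *\<^sub>v unit_vec (g * N\<^sup>2) j) $ i"
    using transformation_matrix_carrier[of k N g h K] i j by auto
  also have "\<dots> = flatten N h (conv k N g K (unit_tensor (r', s', d))) $ i"
    using j by (simp add: transformation_matrix_mult_vec flatten_unit_tensor flip: tj)
  also have "\<dots> = conv k N g K (unit_tensor (r', s', d)) (r, s, c)"
    using flatten_tensor_index[OF i] ti by simp
  also have "\<dots> = (\<Sum>e = 1..g. \<Sum>a = 1..k. \<Sum>b = 1..k.
      if e = d then if int a = p then if int b = q then K (a, b, d, c) else 0 else 0 else 0)"
    unfolding conv_def Let_def prod.case
    using ranges
    by (intro sum.cong refl) (auto simp: zero_padded_def unit_tensor_def p_def q_def)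
  also have "\<dots> = (\<Sum>a = 1..k. \<Sum>b = 1..k.
      if int a = p then if int b = q then K (a, b, d, c) else 0 else 0)"
    using ranges by (subst sum.remove[of _ d]) (auto intro!: sum.neutral)
  also have "\<dots> = (if p \<in> {1..int k} \<and> q \<in> {1..int k} then K (nat p, nat q, d, c) else 0)"
  proof (cases "p \<in> {1..int k} \<and> q \<in> {1..int k}")
    case True
    then have eq: "int a = p \<longleftrightarrow> a = nat p" "int a = q \<longleftrightarrow> a = nat q" for a by auto
    have "(\<Sum>a = 1..k. \<Sum>b = 1..k. if a = nat p then if b = nat q then K (a, b, d, c) else 0 else 0)
        = (\<Sum>a = 1..k. if a = nat p then K (a, nat q, d, c) else 0)"
      using True by (intro sum.cong) auto
    also have "\<dots> = K (nat p, nat q, d, c)" using True by auto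
    finally show ?thesis using True by (simp only: eq if_True simp_thms)
  next
    case False
    then show ?thesis by (auto intro!: sum.neutral)
  qed
  finally show ?thesis unfolding i_def j_def .
qed

end

theory Submission
  imports Defs
begin

text \<open>
  Every entry of the transformation matrix is either identically zero or a single kernel parameter.
  Varying only \<open>K_(p,q,z,y)\<close> therefore differentiates the matrix entrywise to the indicator of
  \<open>\<Omega>_(p,q,z,y)\<close>, and the claim is the product rule for the entries of \<open>M^T M\<close>, followed by
  collecting the terms of the sum over \<open>\<Omega>_(p,q,z,y)\<close>.
\<close>

text \<open>Every 0-based position splits into base-\<open>N\<close> digits and a channel number, so
  the explicit entry formula covers all of the matrix. Which case applies, and which parameter
  occurs, depends on \<open>i\<close> and \<open>j\<close> only; hence one choice serves all
  kernels.\<close>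

lemma transformation_matrix_entry_cases:
  assumes "i < h * N\<^sup>2" "j < g * N\<^sup>2"
  shows "(\<forall>K. transformation_matrix k N g h K $$ (i, j) = 0) \<or>
    (\<exists>a. \<forall>K. transformation_matrix k N g h K $$ (i, j) = K a)"
proof -
  have N: "N > 0" using assms(1) by (cases N) auto
  have decomp: "l div N\<^sup>2 * N\<^sup>2 + l div N mod N * N + l mod N = l" for l
  proof -
    have "l div N\<^sup>2 * N\<^sup>2 + l div N mod N * N = (l div N div N * N + l div N mod N) * N"
      by (simp only: power2_eq_square div_mult2_eq distrib_right mult.assoc)
    then show ?thesis by simp
  qed
  have c: "i div N\<^sup>2 < h" and d: "j div N\<^sup>2 < g"
    using assms by (simp_all add: less_mult_imp_div_less)
  have entry: "transformation_matrix k N g h K $$ (i, j) =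
     (let p = int (j mod N + 1) - int (i mod N + 1) + \<lceil>real k / 2\<rceil>;
          q = int (j div N mod N + 1) - int (i div N mod N + 1) + \<lceil>real k / 2\<rceil>
      in if p \<in> {1..int k} \<and> q \<in> {1..int k}
         then K (nat p, nat q, j div N\<^sup>2 + 1, i div N\<^sup>2 + 1) else 0)" for K
    using transformation_matrix_entry[of "i mod N + 1" N "i div N mod N + 1" "j mod N + 1"
        "j div N mod N + 1" "i div N\<^sup>2 + 1" h "j div N\<^sup>2 + 1" g k K] N c d
    by (simp only: add_diff_cancel_right' decomp Let_def) (simp add: Suc_le_eq)
  show ?thesis unfolding entry Let_def by (auto split: if_splits)
qed

lemma transformation_matrix_fun_upd:
  assumes "i < h * N\<^sup>2" "j < g * N\<^sup>2"
  shows "transformation_matrix k N g h (K(a := x)) $$ (i, j) =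
    (if (i, j) \<in> param_positions k N g h a then x else transformation_matrix k N g h K $$ (i, j))"
  using transformation_matrix_entry_cases[OF assms, of k]
proof
  assume zero: "\<forall>K. transformation_matrix k N g h K $$ (i, j) = 0"
  then have "(i, j) \<notin> param_positions k N g h a"
    \<comment> \<open>The constant kernel 1 separates the zero function from every
      parameter.\<close>
    unfolding param_positions_def by (auto intro!: exI[of _ "\<lambda>_. 1"])
  with zero show ?thesis by simp
next
  assume "\<exists>b. \<forall>K. transformation_matrix k N g h K $$ (i, j) = K b"
  then obtain b where b: "\<And>K. transformation_matrix k N g h K $$ (i, j) = K b" by blast
  have "(i, j) \<in> param_positions k N g h a \<longleftrightarrow> b = a"
  proof
    assume "(i, j) \<in> param_positions k N g h a"
    then have "\<forall>K. transformation_matrix k N g h K $$ (i, j) = K a"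
      by (simp add: param_positions_def)
    then have "K b = K a" for K :: kernel unfolding b by blast
    \<comment> \<open>The indicator kernel of \<open>b\<close> takes the value 1 at \<open>a\<close>
      only if \<open>a = b\<close>, so distinct parameters are distinct functions.\<close>
    from this[of "\<lambda>c. if c = b then 1 else 0"] show "b = a" by (auto split: if_splits)
  qed (use assms b in \<open>simp add: param_positions_def\<close>)
  then show ?thesis by (simp add: b)
qed

lemma param_positions_subset: "param_positions k N g h a \<subseteq> {..<h * N\<^sup>2} \<times> {..<g * N\<^sup>2}"
  by (auto simp: param_positions_def)

lemma frobenius_norm_sq:
  "(frobenius_norm A)\<^sup>2 = (\<Sum>i<dim_row A. \<Sum>j<dim_col A. (A $$ (i, j))\<^sup>2)"
  unfolding frobenius_norm_def by (intro real_sqrt_pow2 sum_nonneg) simp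

lemma gram_shift_entry:
  assumes "A \<in> carrier_mat r n" "a < n" "b < n"
  shows "(transpose_mat A * A - \<alpha> \<cdot>\<^sub>m 1\<^sub>m n) $$ (a, b) =
    (\<Sum>i<r. A $$ (i, a) * A $$ (i, b)) - \<alpha> * of_bool (a = b)"
  using assms by (simp add: scalar_prod_def atLeast0LessThan)

text \<open>The chain rule for each squared entry of \<open>R\<close>, then the product rule for the
  Gram entries; the shift by \<alpha> is constant. The two terms of the product rule yield the two
  inner sums, and the curve \<open>A\<close> is arbitrary, with \<open>E\<close> its entrywise
  derivative at \<open>u\<close>.\<close>

lemma has_real_derivative_frobenius_gram_shift:
  fixes A :: "real \<Rightarrow> real mat" and E :: "nat \<Rightarrow> nat \<Rightarrow> real" and \<alpha> :: real and r n :: nat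
  defines "R \<equiv> (\<lambda>x. transpose_mat (A x) * A x - \<alpha> \<cdot>\<^sub>m 1\<^sub>m n)"
  assumes A: "\<And>x. A x \<in> carrier_mat r n"
    and E: "\<And>i j. i < r \<Longrightarrow> j < n \<Longrightarrow>
      ((\<lambda>x. A x $$ (i, j)) has_real_derivative E i j) (at u)"
  shows "((\<lambda>x. (frobenius_norm (R x))\<^sup>2) has_real_derivative
    2 * (\<Sum>i<r. \<Sum>j<n. E i j * ((\<Sum>t<n. R u $$ (j, t) * A u $$ (i, t)) +
                              (\<Sum>s<n. R u $$ (s, j) * A u $$ (i, s))))) (at u)"
proof -
  let ?R' = "\<lambda>a b. \<Sum>i<r. E i a * A u $$ (i, b) + E i b * A u $$ (i, a)"
  have R: "R x $$ (a, b) = (\<Sum>i<r. A x $$ (i, a) * A x $$ (i, b)) - \<alpha> * of_bool (a = b)"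
    if "a < n" "b < n" for x a b
    unfolding R_def using A that by (rule gram_shift_entry)
  have norm: "(frobenius_norm (R x))\<^sup>2 = (\<Sum>a<n. \<Sum>b<n. (R x $$ (a, b))\<^sup>2)" for x
    using A[of x] by (simp add: frobenius_norm_sq R_def)
  have dR: "((\<lambda>x. R x $$ (a, b)) has_real_derivative ?R' a b) (at u)" if "a < n" "b < n" for a b
  proof -
    have "((\<lambda>x. (\<Sum>i<r. A x $$ (i, a) * A x $$ (i, b)) - \<alpha> * of_bool (a = b))
        has_real_derivative ?R' a b - 0) (at u)"
      using that by (intro DERIV_diff DERIV_sum DERIV_mult E DERIV_const) auto
    then show ?thesis using R[OF that] by simp
  qed
  have "((\<lambda>x. (frobenius_norm (R x))\<^sup>2) has_real_derivative
      (\<Sum>a<n. \<Sum>b<n. 2 * (R u $$ (a, b) * ?R' a b))) (at u)"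
    unfolding norm by (intro DERIV_sum) (auto intro!: derivative_eq_intros dR)
  also have "(\<Sum>a<n. \<Sum>b<n. 2 * (R u $$ (a, b) * ?R' a b)) =
      2 * ((\<Sum>a<n. \<Sum>b<n. \<Sum>i<r. R u $$ (a, b) * (E i a * A u $$ (i, b))) +
           (\<Sum>a<n. \<Sum>b<n. \<Sum>i<r. R u $$ (a, b) * (E i b * A u $$ (i, a))))"
    by (simp add: sum_distrib_left sum.distrib distrib_left)
  \<comment> \<open>The row index moves outermost. Here the differentiated factor sits in column
    \<open>a\<close>, which becomes \<open>j\<close>, while \<open>b\<close> becomes
    \<open>t\<close>.\<close>
  also have "(\<Sum>a<n. \<Sum>b<n. \<Sum>i<r. R u $$ (a, b) * (E i a * A u $$ (i, b))) =
      (\<Sum>i<r. \<Sum>a<n. \<Sum>b<n. R u $$ (a, b) * (E i a * A u $$ (i, b)))"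
    by (simp only: sum.swap[of _ _ "{..<r}"])
  also have "(\<Sum>a<n. \<Sum>b<n. \<Sum>i<r. R u $$ (a, b) * (E i b * A u $$ (i, a))) =
      (\<Sum>i<r. \<Sum>a<n. \<Sum>b<n. R u $$ (a, b) * (E i b * A u $$ (i, a)))"
    by (simp only: sum.swap[of _ _ "{..<r}"])
  \<comment> \<open>In this half the differentiated factor sits in column \<open>b\<close>, so
    \<open>b\<close> has to come before \<open>a\<close> to play the role of \<open>j\<close>;
    \<open>a\<close> becomes \<open>s\<close>.\<close>
  also have "\<dots> = (\<Sum>i<r. \<Sum>b<n. \<Sum>a<n. R u $$ (a, b) * (E i b * A u $$ (i, a)))"
    by (intro sum.cong refl sum.swap)
  finally show ?thesis
    by (simp add: sum_distrib_left sum.distrib distrib_left mult_ac)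
qed

theorem theorem3p1:
  fixes k N g h p q z y :: nat and \<alpha> :: real and K :: kernel
  defines "M \<equiv> transformation_matrix k N g h"
  defines "R \<equiv> (\<lambda>K. transpose_mat (M K) * M K - \<alpha> \<cdot>\<^sub>m 1\<^sub>m (g * N\<^sup>2))"
  assumes "k \<ge> 1" "N \<ge> 1" "g \<ge> 1" "h \<ge> 1"
    and "p \<in> {1..k}" "q \<in> {1..k}" "z \<in> {1..g}" "y \<in> {1..h}"
  shows "\<exists>D. has_partial_derivative (\<lambda>K. (frobenius_norm (R K))\<^sup>2) D K (p, q, z, y) \<and>
    1 / 2 * D =
      (\<Sum>(i, j) \<in> param_positions k N g h (p, q, z, y).
         (\<Sum>t < g * N\<^sup>2. R K $$ (j, t) * M K $$ (i, t)) +
         (\<Sum>s < g * N\<^sup>2. R K $$ (s, j) * M K $$ (i, s)))"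
proof -
  define idx where "idx = (p, q, z, y)"
  define P where "P = param_positions k N g h idx"
  let ?n = "g * N\<^sup>2" and ?r = "h * N\<^sup>2"
  let ?G = "\<lambda>i j. (\<Sum>t<?n. R K $$ (j, t) * M K $$ (i, t)) + (\<Sum>s<?n. R K $$ (s, j) * M K $$ (i, s))"
  \<comment> \<open>The general formula with \<open>E\<close> the indicator of \<open>P\<close>:
    along the coordinate line an entry is either the variable itself or constant.\<close>
  let ?D = "2 * (\<Sum>i<?r. \<Sum>j<?n. of_bool ((i, j) \<in> P) * ?G i j)"
  have "((\<lambda>x. M (K(idx := x)) $$ (i, j)) has_real_derivative of_bool ((i, j) \<in> P)) (at (K idx))"
    if "i < ?r" "j < ?n" for i j
    unfolding M_def transformation_matrix_fun_upd[OF that] P_def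
    by (cases "(i, j) \<in> param_positions k N g h idx") (auto intro!: derivative_eq_intros)
  \<comment> \<open>The curve is the matrix of \<open>K(idx := x)\<close>, taken at
    \<open>K idx\<close>; there the update is trivial, so the values on the right are those at
    \<open>K\<close>.\<close>
  from has_real_derivative_frobenius_gram_shift[OF _ this, where \<alpha> = \<alpha>]
  have "has_partial_derivative (\<lambda>K. (frobenius_norm (R K))\<^sup>2) ?D K idx"
    by (simp add: has_partial_derivative_def R_def M_def transformation_matrix_carrier)
  moreover have "1 / 2 * ?D = (\<Sum>(i, j)\<in>P. ?G i j)"
  proof -
    have "1 / 2 * ?D = (\<Sum>(i, j)\<in>{..<?r} \<times> {..<?n}. of_bool ((i, j) \<in> P) * ?G i j)"
      by (simp only: sum.cartesian_product)
    also have "\<dots> = (\<Sum>(i, j)\<in>P. ?G i j)"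
      \<comment> \<open>Outside \<open>P\<close> the indicator vanishes, and \<open>P\<close> lies
        in the finite index rectangle, so the sum shrinks to \<open>P\<close>.\<close>
      using param_positions_subset[of k N g h idx]
      by (intro sum.mono_neutral_cong_right) (auto simp: P_def)
    finally show ?thesis .
  qed
  ultimately show ?thesis unfolding P_def idx_def by blast
qed

end
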